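(* Let $L\in\mathbb N$ and $0\le p<1$. Consider the Elephant Random Walk with finite ordered memory of length $L$ and acceptance probability $p$, defined as follows. Start with an arbitrary list $\eta_0=(\eta_0(0),\dots,\eta_0(L-1))\in\{\pm1\}^L$ and arbitrary $X_0\in\mathbb Z$. Inductively, at step $n+1$: sample a sign from the list $\eta_n$ by choosing one of its $L$ positions uniformly at random (so each sign is chosen with probability proportional to the number of its occurrences); independently, with probability $p$ keep it and with probability $1-p$ multiply it by $-1$, obtaining the new sign $s_{n+1}$; set $X_{n+1}=X_n+s_{n+1}$; and set $\eta_{n+1}=(\eta_n(1),\dots,\eta_n(L-1),s_{n+1})$ (the oldest entry is discarded). Then $$\lim_{t\to\infty}\frac{X_t}{t}=0\ \text{a.s.},\qquad\frac{X_t}{\sqrt t}\Rightarrow N(0,\sigma^2),\qquad \sigma^2=\frac{L-1+2p}{2(1-p)\big(2(1-p)L+2p-1\big)}.$$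
   Context: $N(0,\sigma^2)$ denotes the centered normal distribution with variance $\sigma^2$ (a point mass at $0$ when $\sigma^2=0$); $\Rightarrow$ denotes convergence in distribution. *)

theory Defs
  imports "HOL-Probability.Probability"
begin

text \<open>Randomness used at one step of the walk: a position chosen uniformly among the
  L positions of the memory list, and independently a coin that is True (keep the sign)
  with probability p and False (flip the sign) with probability 1 - p.\<close>
definition erw_noise :: "nat \<Rightarrow> real \<Rightarrow> (nat \<times> bool) pmf" where
  "erw_noise L p = pair_pmf (pmf_of_set {..<L}) (bernoulli_pmf p)"

definition erw_space :: "nat \<Rightarrow> real \<Rightarrow> (nat \<times> bool) stream measure" where
  "erw_space L p = stream_space (measure_pmf (erw_noise L p))"

definition erw_step :: "int list \<times> int \<Rightarrow> nat \<times> bool \<Rightarrow> int list \<times> int" where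
  "erw_step st ub =
     (let eta = fst st; X = snd st; u = fst ub; b = snd ub;
          s = (if b then eta ! u else - (eta ! u))
      in (tl eta @ [s], X + s))"

primrec erw_state :: "int list \<Rightarrow> int \<Rightarrow> (nat \<times> bool) stream \<Rightarrow> nat \<Rightarrow> int list \<times> int" where
  "erw_state eta0 X0 \<omega> 0 = (eta0, X0)"
| "erw_state eta0 X0 \<omega> (Suc n) = erw_step (erw_state eta0 X0 \<omega> n) (\<omega> !! n)"

definition erw_pos :: "int list \<Rightarrow> int \<Rightarrow> (nat \<times> bool) stream \<Rightarrow> nat \<Rightarrow> int" where
  "erw_pos eta0 X0 \<omega> n = snd (erw_state eta0 X0 \<omega> n)"

definition centered_normal :: "real \<Rightarrow> real measure" where
  "centered_normal v = (if v = 0 then return borel 0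
                        else density lborel (normal_density 0 (sqrt v)))"

end

theory Submission
  imports Defs "HOL-Library.Discrete_Functions"
begin

text \<open>
  Write y_0, ..., y_{L-1} for the memory list, S = sum y_i, T = sum i y_i, a = 2p - 1 and
  r = a/L. The new sign s has conditional mean r S, and S + T changes by L s - S in one step,
  so X + a (S + T) / (L (1 - a)) is a martingale with increments (s - r S) / (1 - a), at bounded
  distance from the walk. Orthogonality of the increments gives a second moment linear in time;
  along the squares this gives the strong law, and unit steps of the walk fill the gaps.

  For the limit law one needs the ergodic average of S^2. The Poisson equation for S^2 has an
  explicit quadratic solution F, so the conditional variance of the increments need not be
  controlled pathwise: with M the martingale and a suitable constant k, the expectation of
  exp(i u (1 - a) M) (1 + u^2 k F) is multiplied in each step by the constant 1 - u^2 v / 2, up to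
  an error of order u^3. Taking u of order t^{-1/2} and iterating t times yields the
  characteristic function of the limit.
\<close>

section \<open>Shift identities and the quadratic corrector\<close>

definition psum :: "(nat \<Rightarrow> real) \<Rightarrow> nat \<Rightarrow> real" where
  "psum y n = (\<Sum>i<n. y i)"

definition pmoment :: "(nat \<Rightarrow> real) \<Rightarrow> nat \<Rightarrow> real" where
  "pmoment y n = (\<Sum>i<n. real i * y i)"

text \<open>The weights (i + 1) (1 - r (L - 1 - j)) of y_i y_j (i < j) are found by comparing coefficients
  in the Poisson equation; its right-hand side and its martingale part are read off in
  \<open>corrector_shift\<close>.\<close>
definition corrector :: "real \<Rightarrow> nat \<Rightarrow> (nat \<Rightarrow> real) \<Rightarrow> real" where
  "corrector r L y =
     (\<Sum>j<L. (1 - r * (real L - 1 - real j)) * y j * (pmoment y j + psum y j))"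

text \<open>Reindexing: adding the plain sum raises the weight of \<open>y (Suc i)\<close> to
  \<open>Suc i\<close>, and on the right \<open>y 0\<close> has weight 0.\<close>

lemma pmoment_psum_shift:
  "pmoment (\<lambda>i. y (Suc i)) n + psum (\<lambda>i. y (Suc i)) n = pmoment y (Suc n)"
  by (induction n) (simp_all add: psum_def pmoment_def algebra_simps)

text \<open>The window slides from the indices 0..L-1 to 1..L, with \<open>y L\<close> as the new
  sign. For r = a/L the first summand on the right is the martingale part, since r S is then the
  conditional mean of \<open>y L\<close>; the remainder depends on S^2 only.\<close>

lemma corrector_shift:
  assumes sq: "\<And>i. i < L \<Longrightarrow> (y i)\<^sup>2 = 1"
  shows "corrector r L (\<lambda>i. y (Suc i)) - corrector r L y =
    (y L - r * psum y L) * pmoment y L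
    - (1 - r * (real L - 1)) * ((psum y L)\<^sup>2 - real L) / 2 + r * real L * (real L - 1) / 2"
proof -
  define N where "N = real L"
  \<comment> \<open>Reindexing j to j + 1: the new term at j = 0 vanishes because
    \<open>pmoment y 0 = 0\<close>, and at n = L the boundary term has coefficient 1.\<close>
  have shift: "(\<Sum>j<n. (1 - r * (N - 1 - real j)) * y (Suc j) * pmoment y (Suc j))
      = (\<Sum>j<n. (1 - r * (N - real j)) * y j * pmoment y j) + (1 - r * (N - real n)) * y n * pmoment y n" for n
    by (induction n) (simp_all add: pmoment_def algebra_simps)
  \<comment> \<open>The weights keep N = L while only the prefix length n varies, which makes the
    identity accessible to induction on n.\<close>
  have key: "n \<le> L \<Longrightarrow> r * psum y n * pmoment y n
      + (\<Sum>j<n. (1 - r * (N - real j)) * y j * pmoment y j)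
      - (\<Sum>j<n. (1 - r * (N - 1 - real j)) * y j * (pmoment y j + psum y j))
      = - (1 - r * (N - 1)) * ((psum y n)\<^sup>2 - real n) / 2 + r * real n * (real n - 1) / 2" for n
  proof (induction n)
    case (Suc n)
    define S T z A B where "S = psum y n" and "T = pmoment y n" and "z = y n"
      and "A = (\<Sum>j<n. (1 - r * (N - real j)) * y j * pmoment y j)"
      and "B = (\<Sum>j<n. (1 - r * (N - 1 - real j)) * y j * (pmoment y j + psum y j))"
    note defs = S_def[symmetric] T_def[symmetric] z_def[symmetric] A_def[symmetric] B_def[symmetric]
    have z: "z * z = 1" using sq[of n] Suc.prems by (simp add: z_def power2_eq_square)
    have IH: "r * S * T + A - B = - (1 - r * (N - 1)) * (S\<^sup>2 - real n) / 2 + r * real n * (real n - 1) / 2"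
      using Suc unfolding defs by simp
    have s: "psum y (Suc n) = S + z" "pmoment y (Suc n) = T + real n * z"
      by (simp_all add: psum_def pmoment_def S_def T_def z_def)
    \<comment> \<open>The terms in z T cancel and the coefficient of z S becomes independent of n;
      this is the effect of the weights in \<open>corrector\<close>.\<close>
    have "r * (S + z) * (T + real n * z) + (A + (1 - r * (N - real n)) * z * T)
        - (B + (1 - r * (N - 1 - real n)) * z * (T + S))
        = (r * S * T + A - B) - (1 - r * (N - 1)) * z * S + r * real n * (z * z)"
      by (simp add: algebra_simps)
    also have "\<dots> = - (1 - r * (N - 1)) * ((S + z)\<^sup>2 - real (Suc n)) / 2
        + r * real (Suc n) * (real (Suc n) - 1) / 2"
      unfolding IH power2_sum power2_eq_square[of z] z by (simp add: field_simps)
    finally show ?case by (simp only: s sum.lessThan_Suc defs)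
  qed (simp_all add: psum_def pmoment_def)
  define A where "A = (\<Sum>j<L. (1 - r * (N - real j)) * y j * pmoment y j)"
  have "corrector r L (\<lambda>i. y (Suc i)) = A + y L * pmoment y L"
    unfolding corrector_def pmoment_psum_shift using shift[of L] by (simp add: N_def A_def)
  moreover have "r * psum y L * pmoment y L + A - corrector r L y =
      - (1 - r * (N - 1)) * ((psum y L)\<^sup>2 - N) / 2 + r * N * (N - 1) / 2"
    using key[OF order.refl] by (simp only: corrector_def N_def A_def)
  ultimately show ?thesis
    unfolding N_def by (simp add: left_diff_distrib minus_divide_left)
qed

section \<open>The law of the state after n steps\<close>

primrec erw_law :: "nat \<Rightarrow> real \<Rightarrow> int list \<times> int \<Rightarrow> nat \<Rightarrow> (int list \<times> int) pmf" where
  "erw_law L p st 0 = return_pmf st"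
| "erw_law L p st (Suc n) = erw_law L p st n \<bind> (\<lambda>s. map_pmf (erw_step s) (erw_noise L p))"

text \<open>The recursion of \<open>erw_law\<close> adds the last step, whereas a stream is taken
  apart at its head. This bridges the two for the induction in
  \<open>distr_erw_state\<close>.\<close>

lemma erw_law_Suc_front:
  "erw_law L p st (Suc n) = erw_noise L p \<bind> (\<lambda>x. erw_law L p (erw_step st x) n)"
proof (induction n)
  case (Suc n)
  have "erw_law L p st (Suc (Suc n)) =
      (erw_noise L p \<bind> (\<lambda>x. erw_law L p (erw_step st x) n)) \<bind>
        (\<lambda>s. map_pmf (erw_step s) (erw_noise L p))"
    using Suc by simp
  then show ?case by (simp add: bind_assoc_pmf)
qed (simp add: bind_return_pmf map_pmf_def)

lemma erw_state_Suc_front: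
  "erw_state eta X (x ## \<omega>) (Suc n) =
     erw_state (fst (erw_step (eta, X) x)) (snd (erw_step (eta, X) x)) \<omega> n"
  by (induction n) simp_all

lemma prob_space_erw_space: "prob_space (erw_space L p)"
  unfolding erw_space_def
  by (rule prob_space.prob_space_stream_space[OF measure_pmf.prob_space_axioms])

lemma measurable_erw_state [measurable]:
  "(\<lambda>\<omega>. erw_state eta X \<omega> n) \<in> measurable (erw_space L p) (count_space UNIV)"
proof (induction n)
  case (Suc n)
  have "(\<lambda>\<omega>. \<omega> !! n) \<in> measurable (erw_space L p) (measure_pmf (erw_noise L p))"
    unfolding erw_space_def by (rule measurable_snth)
  then have m: "(\<lambda>\<omega>. \<omega> !! n) \<in> measurable (erw_space L p) (count_space UNIV)"
    by (simp cong: measurable_cong_sets)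
  have "(\<lambda>\<omega>. erw_step s (\<omega> !! n)) \<in> measurable (erw_space L p) (count_space UNIV)" for s
    by (rule measurable_compose[OF m]) simp
  \<comment> \<open>The state type is countable, so it suffices to treat the step from each fixed
    state s.\<close>
  then show ?case
    using measurable_compose_countable[OF _ Suc, of "\<lambda>s \<omega>. erw_step s (\<omega> !! n)"] by simp
qed simp

text \<open>Transfers expectations and almost sure statements at a fixed time to a finitely
  supported pmf, where integrability is free. The induction splits off the first noise variable,
  hence the start state is generalised.\<close>

lemma distr_erw_state:
  "distr (erw_space L p) (count_space UNIV) (\<lambda>\<omega>. erw_state eta X \<omega> n) =
   measure_pmf (erw_law L p (eta, X) n)"
proof (rule measure_eqI)
  fix A assume "A \<in> sets (distr (erw_space L p) (count_space UNIV) (\<lambda>\<omega>. erw_state eta X \<omega> n))"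
  have "emeasure (erw_space L p) {\<omega> \<in> space (erw_space L p). erw_state eta X \<omega> n \<in> A} =
      emeasure (erw_law L p (eta, X) n) A"
  proof (induction n arbitrary: eta X)
    case 0
    interpret prob_space "erw_space L p" by (rule prob_space_erw_space)
    show ?case by (cases "(eta, X) \<in> A") (auto simp: emeasure_space_1)
  next
    case (Suc n)
    have "{\<omega> \<in> space (erw_space L p). erw_state eta X \<omega> (Suc n) \<in> A} \<in> sets (erw_space L p)"
      using measurable_sets[OF measurable_erw_state, of A]
      by (auto simp: vimage_def Int_def conj_commute simp del: erw_state.simps)
    then have "emeasure (erw_space L p) {\<omega> \<in> space (erw_space L p). erw_state eta X \<omega> (Suc n) \<in> A} =
      (\<integral>\<^sup>+x. emeasure (erw_space L p) {\<omega> \<in> space (erw_space L p).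
         x ## \<omega> \<in> {\<omega> \<in> space (erw_space L p). erw_state eta X \<omega> (Suc n) \<in> A}} \<partial>erw_noise L p)"
      unfolding erw_space_def
      by (rule prob_space.emeasure_stream_space[OF measure_pmf.prob_space_axioms])
    also have "\<dots> = (\<integral>\<^sup>+x. emeasure (erw_law L p (erw_step (eta, X) x) n) A \<partial>erw_noise L p)"
    proof (rule nn_integral_cong)
      fix x
      have "{\<omega> \<in> space (erw_space L p).
         x ## \<omega> \<in> {\<omega> \<in> space (erw_space L p). erw_state eta X \<omega> (Suc n) \<in> A}} =
         {\<omega> \<in> space (erw_space L p).
           erw_state (fst (erw_step (eta, X) x)) (snd (erw_step (eta, X) x)) \<omega> n \<in> A}"
        by (auto simp: erw_state_Suc_front erw_space_def space_stream_space streams_UNIV simp del: erw_state.simps)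
      then show "emeasure (erw_space L p) {\<omega> \<in> space (erw_space L p).
         x ## \<omega> \<in> {\<omega> \<in> space (erw_space L p). erw_state eta X \<omega> (Suc n) \<in> A}} =
         emeasure (erw_law L p (erw_step (eta, X) x) n) A"
        by (simp add: Suc)
    qed
    also have "\<dots> = emeasure (erw_law L p (eta, X) (Suc n)) A"
      by (simp only: erw_law_Suc_front emeasure_bind_pmf)
    finally show ?case .
  qed
  then show "emeasure (distr (erw_space L p) (count_space UNIV) (\<lambda>\<omega>. erw_state eta X \<omega> n)) A =
      emeasure (erw_law L p (eta, X) n) A"
    by (simp add: emeasure_distr vimage_def Int_def conj_commute)
qed simp

section \<open>Memory lists as windows of a sequence\<close>

definition erw_sign :: "int list \<Rightarrow> nat \<times> bool \<Rightarrow> int" where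
  "erw_sign eta x = (if snd x then eta ! fst x else - (eta ! fst x))"

lemma erw_step_eq: "erw_step (eta, X) x = (tl eta @ [erw_sign eta x], X + erw_sign eta x)"
  by (simp add: erw_step_def erw_sign_def Let_def)

definition erw_mem :: "nat \<Rightarrow> int list set" where
  "erw_mem L = {eta. set eta \<subseteq> {-1, 1} \<and> length eta = L}"

lemma finite_erw_mem: "finite (erw_mem L)"
  unfolding erw_mem_def by (rule finite_lists_length_eq) simp

lemma erw_sign_mem:
  assumes "eta \<in> erw_mem L" "fst x < L"
  shows "erw_sign eta x \<in> {-1, 1}"
  proof -
  have "eta ! fst x \<in> {-1, 1}"
    using assms nth_mem[of "fst x" eta] unfolding erw_mem_def by blast
  then show ?thesis by (auto simp: erw_sign_def)
qed

lemma psum_cong: "(\<And>i. i < n \<Longrightarrow> y i = z i) \<Longrightarrow> psum y n = psum z n"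
  by (simp add: psum_def)

lemma pmoment_cong: "(\<And>i. i < n \<Longrightarrow> y i = z i) \<Longrightarrow> pmoment y n = pmoment z n"
  by (simp add: pmoment_def)

lemma corrector_cong:
  assumes "\<And>i. i < L \<Longrightarrow> y i = z i"
  shows "corrector r L y = corrector r L z"
  unfolding corrector_def
proof (intro sum.cong refl)
  fix j assume "j \<in> {..<L}"
  then have "psum y j = psum z j" "pmoment y j = pmoment z j" "y j = z j"
    using assms by (auto intro!: psum_cong pmoment_cong)
  then show "(1 - r * (real L - 1 - real j)) * y j * (pmoment y j + psum y j) =
      (1 - r * (real L - 1 - real j)) * z j * (pmoment z j + psum z j)" by simp
qed

abbreviation memr :: "int list \<Rightarrow> nat \<Rightarrow> real" where
  "memr eta \<equiv> (\<lambda>i. real_of_int (eta ! i))"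

lemma memr_sq:
  assumes "eta \<in> erw_mem L" "i < L"
  shows "(memr eta i)\<^sup>2 = 1"
proof -
  have "eta ! i \<in> {-1, 1}" using assms nth_mem[of i eta] unfolding erw_mem_def by blast
  then show ?thesis by auto
qed

lemma abs_psum_memr_le:
  assumes "eta \<in> erw_mem L"
  shows "\<bar>psum (memr eta) L\<bar> \<le> real L"
proof -
  have "\<bar>memr eta i\<bar> \<le> 1" if "i < L" for i
    using memr_sq[OF assms that] by (simp add: abs_square_eq_1)
  then have "(\<Sum>i<L. \<bar>memr eta i\<bar>) \<le> real L"
    using sum_bounded_above[of "{..<L}" "\<lambda>i. \<bar>memr eta i\<bar>" 1] by simp
  then show ?thesis unfolding psum_def using sum_abs[of "memr eta" "{..<L}"] by linarith
qed

text \<open>Old and new memory are the windows 0..L-1 and 1..L of the single sequence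
  \<open>eta @ [s]\<close>, so both claims reduce to the shift identities.\<close>

lemma
  fixes eta :: "int list" and s :: int
  assumes "length eta = L" "L \<ge> 1"
  defines "y \<equiv> \<lambda>i. memr (eta @ [s]) i"
  shows pmoment_memr_step: "pmoment (memr (tl eta @ [s])) L + psum (memr (tl eta @ [s])) L =
        pmoment (memr eta) L + real L * real_of_int s"
    and corrector_memr_step: "(\<And>i. i < L \<Longrightarrow> (memr eta i)\<^sup>2 = 1) \<Longrightarrow>
        corrector r L (memr (tl eta @ [s])) - corrector r L (memr eta) =
        (real_of_int s - r * psum (memr eta) L) * pmoment (memr eta) L
        - (1 - r * (real L - 1)) * ((psum (memr eta) L)\<^sup>2 - real L) / 2 + r * real L * (real L - 1) / 2"
proof -
  have a: "i < L \<Longrightarrow> memr (tl eta @ [s]) i = y (Suc i)" for i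
    using assms by (auto simp: y_def nth_append nth_tl)
  have b: "i < L \<Longrightarrow> memr eta i = y i" for i
    using assms by (auto simp: y_def nth_append)
  have c: "y L = real_of_int s" using assms by (simp add: y_def nth_append)
  have ps: "psum (memr (tl eta @ [s])) L = psum (\<lambda>i. y (Suc i)) L" "psum (memr eta) L = psum y L"
    using a b by (auto intro: psum_cong)
  have pm: "pmoment (memr (tl eta @ [s])) L = pmoment (\<lambda>i. y (Suc i)) L" "pmoment (memr eta) L = pmoment y L"
    using a b by (auto intro: pmoment_cong)
  have co: "corrector r L (memr (tl eta @ [s])) = corrector r L (\<lambda>i. y (Suc i))"
      "corrector r L (memr eta) = corrector r L y"
    using a b by (auto intro: corrector_cong)
  show "pmoment (memr (tl eta @ [s])) L + psum (memr (tl eta @ [s])) L =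
        pmoment (memr eta) L + real L * real_of_int s"
    unfolding ps pm pmoment_psum_shift using c by (simp add: pmoment_def)
  assume "\<And>i. i < L \<Longrightarrow> (memr eta i)\<^sup>2 = 1"
  then have "i < L \<Longrightarrow> (y i)\<^sup>2 = 1" for i using b by simp
  then show "corrector r L (memr (tl eta @ [s])) - corrector r L (memr eta) =
        (real_of_int s - r * psum (memr eta) L) * pmoment (memr eta) L
        - (1 - r * (real L - 1)) * ((psum (memr eta) L)\<^sup>2 - real L) / 2 + r * real L * (real L - 1) / 2"
    unfolding ps pm co using corrector_shift[of L y r] c by simp
qed

section \<open>The martingale, the scaled corrector and their constants\<close>

definition erw_drift :: "nat \<Rightarrow> real \<Rightarrow> int list \<Rightarrow> real" where
  "erw_drift L p eta = (2 * p - 1) / real L * psum (memr eta) L"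

definition erw_mart :: "nat \<Rightarrow> real \<Rightarrow> int list \<times> int \<Rightarrow> real" where
  "erw_mart L p st = real_of_int (snd st) + (2 * p - 1) / (2 * (1 - p) * real L) *
     (pmoment (memr (fst st)) L + psum (memr (fst st)) L)"

definition erw_corrector :: "nat \<Rightarrow> real \<Rightarrow> int list \<Rightarrow> real" where
  "erw_corrector L p eta = corrector ((2 * p - 1) / real L) L (memr eta)"

text \<open>Equals L (1 - r (L - 1)) with r = (2 p - 1) / L, that is, L times the factor in front of
  S^2 in \<open>corrector_shift\<close>, up to -1/2.\<close>

definition erw_den :: "nat \<Rightarrow> real \<Rightarrow> real" where
  "erw_den L p = 2 * (1 - p) * real L + 2 * p - 1"

definition erw_rate :: "nat \<Rightarrow> real \<Rightarrow> real" where
  "erw_rate L p = 1 - (2 * p - 1)\<^sup>2 / erw_den L p"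

definition erw_kappa :: "nat \<Rightarrow> real \<Rightarrow> real" where
  "erw_kappa L p = (2 * p - 1)\<^sup>2 / (real L * erw_den L p)"

text \<open>The coefficient \<open>erw_kappa\<close> is the one for which the S^2 terms cancel in the one-step
  expectation; \<open>erw_rate\<close> is the stationary mean of the conditional
  variance of s - r S.\<close>
definition erw_pert :: "nat \<Rightarrow> real \<Rightarrow> real \<Rightarrow> int list \<times> int \<Rightarrow> complex" where
  "erw_pert L p u st = iexp (2 * (1 - p) * u * erw_mart L p st) * of_real (1 + u\<^sup>2 * erw_kappa L p * erw_corrector L p (fst st))"

section \<open>Auxiliary facts on exponentials, normal laws and real limits\<close>

lemma norm_expectation_diff_le:
  fixes f g :: "'a \<Rightarrow> 'b::{banach, second_countable_topology}"
  assumes fin: "finite (set_pmf P)" and le: "\<And>x. x \<in> set_pmf P \<Longrightarrow> norm (f x - g x) \<le> C"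
  shows "norm (measure_pmf.expectation P f - measure_pmf.expectation P g) \<le> C"
proof -
  note int = integrable_measure_pmf_finite[OF fin]
  have "norm (measure_pmf.expectation P f - measure_pmf.expectation P g)
      = norm (measure_pmf.expectation P (\<lambda>x. f x - g x))"
    by (subst Bochner_Integration.integral_diff[OF int int]) simp
  also have "\<dots> \<le> measure_pmf.expectation P (\<lambda>x. norm (f x - g x))"
    by (rule integral_norm_bound)
  also have "\<dots> \<le> measure_pmf.expectation P (\<lambda>x. C)"
    using le by (intro integral_mono_AE int) (simp add: AE_measure_pmf_iff)
  finally show ?thesis by simp
qed

lemma norm_iexp_minus_1_le: "norm (iexp x - 1) \<le> \<bar>x\<bar>"
  using iexp_approx1[of x 0] by simp

lemma norm_iexp_diff_le: "norm (iexp x - iexp y) \<le> \<bar>x - y\<bar>"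
proof -
  have "iexp x - iexp y = iexp y * (iexp (x - y) - 1)"
    by (simp add: algebra_simps exp_diff)
  then have "norm (iexp x - iexp y) = norm (iexp (x - y) - 1)"
    by (simp add: norm_mult)
  then show ?thesis using norm_iexp_minus_1_le[of "x - y"] by simp
qed

text \<open>The quadratic term carries the variance and must be kept; for arguments of order
  t^(-1/2), t cubic remainders still add up to order t^(-1/2).\<close>

lemma norm_iexp_taylor2_le:
  "norm (iexp x - (1 + \<i> * of_real x - of_real (x\<^sup>2) / 2)) \<le> \<bar>x\<bar> ^ 3 / 6"
proof -
  have "(\<Sum>k\<le>2. (\<i> * of_real x) ^ k / fact k) = 1 + \<i> * of_real x - of_real (x\<^sup>2) / 2"
    by (simp add: numeral_2_eq_2 power_mult_distrib)
  then show ?thesis using iexp_approx1[of x 2] by (simp add: fact_numeral numeral_eq_Suc)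
qed

text \<open>Variance 0 does occur: the numerator L - 1 + 2 p vanishes for L = 1 and p = 0, where the
  signs alternate.\<close>

lemma real_distribution_centered_normal:
  assumes "0 \<le> v"
  shows "real_distribution (centered_normal v)"
proof (cases "v = 0")
  case True
  then show ?thesis
    by (simp add: centered_normal_def real_distribution_def real_distribution_axioms_def prob_space_return)
next
  case False
  then show ?thesis using assms
    by (simp add: centered_normal_def real_distribution_def real_distribution_axioms_def prob_space_normal_density)
qed

lemma char_centered_normal:
  assumes "0 \<le> v"
  shows "char (centered_normal v) t = of_real (exp (- (v * t\<^sup>2 / 2)))"
proof (cases "v = 0")
  case True
  then show ?thesis by (simp add: centered_normal_def char_def integral_return)
next
  case False
  define \<sigma> where "\<sigma> = sqrt v"
  have \<sigma>: "\<sigma> > 0" "\<sigma>\<^sup>2 = v" using False assms by (auto simp: \<sigma>_def)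
  interpret N: real_distribution std_normal_distribution by (rule real_dist_normal_dist)
  \<comment> \<open>The identity is a standard normal variable on this space, and scaling it by the
    standard deviation gives the law sought.\<close>
  have "distributed std_normal_distribution lborel (\<lambda>x. x) std_normal_density"
    by (auto simp: distributed_def distr_id2)
  from N.normal_density_affine[OF this _ , of \<sigma> 0]
  have "distributed std_normal_distribution lborel (\<lambda>x. \<sigma> * x) (normal_density 0 \<sigma>)"
    using \<sigma> by simp
  then have "distr std_normal_distribution lborel (\<lambda>x. \<sigma> * x) = density lborel (normal_density 0 \<sigma>)"
    by (simp add: distributed_def)
  then have *: "centered_normal v = distr std_normal_distribution borel (\<lambda>x. \<sigma> * x)"
    using False by (simp add: centered_normal_def \<sigma>_def cong: distr_cong)
  have "char (centered_normal v) t = char std_normal_distribution (\<sigma> * t)"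
    unfolding * char_def by (subst integral_distr) (auto simp: mult_ac)
  then show ?thesis using \<sigma> by (simp add: char_std_normal_distribution power_mult_distrib)
qed

text \<open>If n^2 <= t < (n + 1)^2, then t is at most 2 n steps away from n^2, which is negligible
  against t.\<close>

lemma LIMSEQ_of_bounded_steps:
  fixes x :: "nat \<Rightarrow> real"
  assumes step: "\<And>n. \<bar>x (Suc n) - x n\<bar> \<le> 1"
    and sub: "(\<lambda>k. x (k\<^sup>2) / (real k)\<^sup>2) \<longlonglongrightarrow> 0"
  shows "(\<lambda>t. x t / real t) \<longlonglongrightarrow> 0"
proof -
  define k where "k t = floor_sqrt t" for t
  \<comment> \<open>The second summand is the gap 2 k between consecutive squares divided by
    k^2.\<close>
  define g where "g k = \<bar>x (k\<^sup>2) / (real k)\<^sup>2\<bar> + 2 / real k" for k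
  have k: "filterlim k at_top sequentially"
    unfolding filterlim_at_top
  proof
    fix m
    have "m \<le> k t" if "m\<^sup>2 \<le> t" for t using that by (simp add: k_def le_floor_sqrt_iff)
    then show "\<forall>\<^sub>F t in sequentially. m \<le> k t" by (rule eventually_sequentiallyI[of "m\<^sup>2"])
  qed
  have g: "g \<longlonglongrightarrow> 0"
    using tendsto_add[OF tendsto_rabs_zero[OF sub] lim_const_over_n[of 2]] by (simp add: g_def[abs_def])
  have le: "norm (x t / real t) \<le> g (k t)" if "1 \<le> t" for t
  proof -
    define n where "n = k t"
    have n: "n\<^sup>2 \<le> t" "t < (Suc n)\<^sup>2" "n \<ge> 1"
      using that Suc_floor_sqrt_power2_gt[of t] by (auto simp: n_def k_def le_floor_sqrt_iff)
    have "\<bar>x (m + d) - x m\<bar> \<le> real d" for m d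
    proof (induction d)
      case (Suc d)
      then show ?case using step[of "m + d"] by simp
    qed simp
    from this[of "n\<^sup>2" "t - n\<^sup>2"] have 1: "\<bar>x t - x (n\<^sup>2)\<bar> \<le> real t - (real n)\<^sup>2"
      using n by (simp add: of_nat_diff)
    have "t \<le> n\<^sup>2 + 2 * n" using n(2) by (simp add: power2_eq_square)
    then have "real t \<le> real (n\<^sup>2 + 2 * n)" by (rule of_nat_mono)
    then have "real t - (real n)\<^sup>2 \<le> 2 * real n" by simp
    with 1 have d: "\<bar>x t\<bar> \<le> \<bar>x (n\<^sup>2)\<bar> + 2 * real n" by linarith
    have "norm (x t / real t) \<le> (\<bar>x (n\<^sup>2)\<bar> + 2 * real n) / real t"
      using d by (simp add: divide_right_mono)
    also have "\<dots> \<le> (\<bar>x (n\<^sup>2)\<bar> + 2 * real n) / (real n)\<^sup>2"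
      using n that by (intro divide_left_mono) auto
    also have "\<dots> = \<bar>x (n\<^sup>2) / (real n)\<^sup>2\<bar> + 2 / real n"
      using n(3) by (simp add: add_divide_distrib power2_eq_square)
    finally show ?thesis by (simp add: n_def g_def)
  qed
  show ?thesis
    by (rule Lim_null_comparison[OF eventually_sequentiallyI[of 1, OF le] filterlim_compose[OF g k]])
qed

lemma LIMSEQ_power_scaled:
  fixes \<tau> :: real
  shows "(\<lambda>n. (1 - (c / sqrt (real n))\<^sup>2 * \<tau> / 2) ^ n) \<longlonglongrightarrow> exp (- (\<tau> * c\<^sup>2 / 2))"
proof -
  have "(\<lambda>n. (1 + (- (\<tau> * c\<^sup>2 / 2)) / real n) ^ n) \<longlonglongrightarrow> exp (- (\<tau> * c\<^sup>2 / 2))"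
    by (rule tendsto_exp_limit_sequentially)
  \<comment> \<open>This includes n = 0, where the quotients on both sides are 0 by the convention
    for division by zero.\<close>
  moreover have "1 - (c / sqrt (real n))\<^sup>2 * \<tau> / 2 = 1 + (- (\<tau> * c\<^sup>2 / 2)) / real n" for n
    by (simp add: power_divide mult.commute)
  ultimately show ?thesis by (simp only:)
qed

lemma borel_measurable_erw_state:
  "(\<lambda>\<omega>. f (erw_state eta X \<omega> n)) \<in> measurable (erw_space L p) borel"
  by (rule measurable_compose[OF measurable_erw_state, where g = f]) simp

section \<open>Support of the noise and one-step expectations\<close>

locale elephant =
  fixes L :: nat and p :: real
  assumes L: "L \<ge> 1" and p0: "0 \<le> p" and p1: "p < 1"
begin

lemma set_erw_noise: "set_pmf (erw_noise L p) \<subseteq> {..<L} \<times> UNIV"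
  using L by (auto simp: erw_noise_def lessThan_empty_iff)

lemma finite_erw_noise: "finite (set_pmf (erw_noise L p))"
  by (rule finite_subset[OF set_erw_noise]) simp

lemma finite_erw_law: "finite (set_pmf (erw_law L p st n))"
  by (induction n) (simp_all add: finite_erw_noise)

text \<open>The tower property: conditioning on the state after n steps leaves an average over one
  noise variable.\<close>

lemma expectation_erw_law_Suc:
  fixes f :: "int list \<times> int \<Rightarrow> 'b::{banach, second_countable_topology}"
  shows "measure_pmf.expectation (erw_law L p st (Suc n)) f =
     measure_pmf.expectation (erw_law L p st n)
       (\<lambda>s. measure_pmf.expectation (erw_noise L p) (\<lambda>x. f (erw_step s x)))"
  using pmf_expectation_bind[where p = "erw_law L p st n" and A = "set_pmf (erw_law L p st n)"
      and f = "\<lambda>s. map_pmf (erw_step s) (erw_noise L p)" and h = f] finite_erw_law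
    finite_erw_noise
  by (simp add: integral_measure_pmf[OF finite_erw_law])

lemma erw_step_mem:
  assumes "fst st \<in> erw_mem L" "fst x < L"
  shows "fst (erw_step st x) \<in> erw_mem L"
proof -
  have "erw_sign (fst st) x \<in> {-1, 1}" using assms by (rule erw_sign_mem)
  moreover have "set (tl (fst st)) \<subseteq> set (fst st)"
    by (cases "fst st") auto
  moreover have "erw_step st x = (tl (fst st) @ [erw_sign (fst st) x], snd st + erw_sign (fst st) x)"
    using erw_step_eq[of "fst st" "snd st" x] by simp
  ultimately show ?thesis using assms(1) L unfolding erw_mem_def by auto
qed

lemma erw_law_mem:
  assumes "fst st \<in> erw_mem L" "s \<in> set_pmf (erw_law L p st n)"
  shows "fst s \<in> erw_mem L"
  using assms
proof (induction n arbitrary: s)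
  case (Suc n)
  then obtain s' x where "s' \<in> set_pmf (erw_law L p st n)" "x \<in> set_pmf (erw_noise L p)"
    and s: "s = erw_step s' x" by auto
  then have "fst s' \<in> erw_mem L" "fst x < L" using Suc set_erw_noise by auto
  then show ?case unfolding s by (rule erw_step_mem)
qed simp

text \<open>Position u yields its entry with weight p / L and the negated entry with weight (1 - p)
  / L.\<close>

lemma expectation_erw_sign:
  assumes "eta \<in> erw_mem L"
  shows "measure_pmf.expectation (erw_noise L p) (\<lambda>x. real_of_int (erw_sign eta x)) =
    (2 * p - 1) / real L * psum (\<lambda>i. real_of_int (eta ! i)) L"
proof -
  have ne: "{..<L} \<noteq> {}" using L by (auto simp: lessThan_empty_iff)
  have "measure_pmf.expectation (erw_noise L p) (\<lambda>x. real_of_int (erw_sign eta x)) =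
     (\<Sum>x\<in>{..<L}\<times>UNIV. real_of_int (erw_sign eta x) * pmf (erw_noise L p) x)"
    by (rule integral_measure_pmf_real) (use set_erw_noise in auto)
  also have "\<dots> = (\<Sum>u<L. \<Sum>b\<in>UNIV. real_of_int (erw_sign eta (u, b)) * pmf (erw_noise L p) (u, b))"
    by (simp add: sum.cartesian_product)
  also have "\<dots> = (\<Sum>u<L. (2 * p - 1) / real L * real_of_int (eta ! u))"
    using ne p0 p1 by (intro sum.cong)
      (auto simp: UNIV_bool erw_noise_def pmf_pair erw_sign_def pmf_of_set field_simps)
  finally show ?thesis by (simp add: psum_def sum_distrib_left)
qed

lemma abs_erw_drift_le: "eta \<in> erw_mem L \<Longrightarrow> \<bar>erw_drift L p eta\<bar> \<le> 1"
proof -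
  assume "eta \<in> erw_mem L"
  then have "\<bar>2 * p - 1\<bar> * \<bar>psum (memr eta) L\<bar> \<le> 1 * real L"
    using p0 p1 by (intro mult_mono abs_psum_memr_le) auto
  then show ?thesis using L by (simp add: erw_drift_def abs_mult divide_le_eq)
qed

text \<open>The memory term compensates the drift: with b L = a / (1 - a) and 1 - a = 2 (1 - p), the
  change s + b (L s - S) equals (s - r S) / (1 - a).\<close>

lemma erw_mart_step:
  assumes "eta \<in> erw_mem L"
  shows "erw_mart L p (erw_step (eta, X) x) =
    erw_mart L p (eta, X) + (real_of_int (erw_sign eta x) - erw_drift L p eta) / (2 * (1 - p))"
proof -
  define s where "s = erw_sign eta x"
  define b where "b = (2 * p - 1) / (2 * (1 - p) * real L)"
  have b: "b * real L * (2 * (1 - p)) = 2 * p - 1" using L p1 by (simp add: b_def)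
  have "erw_mart L p (erw_step (eta, X) x) = real_of_int X + real_of_int s
      + b * (pmoment (memr eta) L + real L * real_of_int s)"
    using assms L by (simp add: erw_mart_def erw_step_eq pmoment_memr_step erw_mem_def s_def b_def)
  also have "\<dots> - erw_mart L p (eta, X) = real_of_int s + b * (real L * real_of_int s - psum (memr eta) L)"
    unfolding erw_mart_def fst_conv snd_conv b_def[symmetric] by (simp add: algebra_simps)
  also have "\<dots> = (real_of_int s - erw_drift L p eta) / (2 * (1 - p))"
    unfolding b_def erw_drift_def using L p1 by (simp add: divide_simps) (simp add: algebra_simps)
  finally show ?thesis by (simp add: s_def)
qed

text \<open>Since s^2 = 1, polynomials in the new sign are affine in it. The one-step expectations
  below are brought into this form, with complex coefficients for the exponentials.\<close>

lemma expectation_affine_sign: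
  fixes A B :: "'b::{real_normed_field, banach, second_countable_topology}"
  assumes "eta \<in> erw_mem L"
  shows "measure_pmf.expectation (erw_noise L p) (\<lambda>x. A + B * of_real (real_of_int (erw_sign eta x))) =
    A + B * of_real (erw_drift L p eta)"
proof -
  note int = integrable_measure_pmf_finite[OF finite_erw_noise]
  have "measure_pmf.expectation (erw_noise L p) (\<lambda>x. A + B * of_real (real_of_int (erw_sign eta x))) =
    measure_pmf.expectation (erw_noise L p) (\<lambda>x. A) +
    measure_pmf.expectation (erw_noise L p) (\<lambda>x. B * of_real (real_of_int (erw_sign eta x)))"
    by (rule Bochner_Integration.integral_add[OF int int])
  also have "\<dots> = A + B * of_real (measure_pmf.expectation (erw_noise L p) (\<lambda>x. real_of_int (erw_sign eta x)))"
    by (subst Bochner_Integration.integral_mult_right[OF int], subst integral_of_real) (simp_all add: int)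
  also have "\<dots> = A + B * of_real (erw_drift L p eta)"
    unfolding expectation_erw_sign[OF assms] erw_drift_def ..
  finally show ?thesis .
qed

lemma expectation_noise_cong:
  fixes f g :: "nat \<times> bool \<Rightarrow> 'b::{banach, second_countable_topology}"
  assumes "\<And>x. fst x < L \<Longrightarrow> f x = g x"
  shows "measure_pmf.expectation (erw_noise L p) f = measure_pmf.expectation (erw_noise L p) g"
  by (intro integral_cong_AE) (use assms set_erw_noise in \<open>auto simp: AE_measure_pmf_iff\<close>)

lemma erw_sign_sq:
  assumes "eta \<in> erw_mem L" "fst x < L"
  shows "real_of_int (erw_sign eta x) * real_of_int (erw_sign eta x) = 1"
  using erw_sign_mem[OF assms] by auto

section \<open>Second moment of the martingale\<close>

lemma expectation_erw_mart_sq_step: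
  assumes "eta \<in> erw_mem L"
  shows "measure_pmf.expectation (erw_noise L p) (\<lambda>x. (erw_mart L p (erw_step (eta, X) x))\<^sup>2) \<le>
    (erw_mart L p (eta, X))\<^sup>2 + 1 / (1 - p)\<^sup>2"
proof -
  define M q c where "M = erw_mart L p (eta, X)" and "q = erw_drift L p eta" and "c = 1 / (2 * (1 - p))"
  have "measure_pmf.expectation (erw_noise L p) (\<lambda>x. (erw_mart L p (erw_step (eta, X) x))\<^sup>2) =
    measure_pmf.expectation (erw_noise L p) (\<lambda>x. (M\<^sup>2 - 2 * M * q * c + c\<^sup>2 * (1 + q\<^sup>2)) +
       (2 * M * c - 2 * q * c\<^sup>2) * of_real (real_of_int (erw_sign eta x)))"
  proof (rule expectation_noise_cong)
    fix x :: "nat \<times> bool" assume "fst x < L"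
    define s where "s = real_of_int (erw_sign eta x)"
    have s: "s * s = 1" unfolding s_def by (rule erw_sign_sq) fact+
    have "(M + (s - q) * c)\<^sup>2 = (M\<^sup>2 - 2 * M * q * c + c\<^sup>2 * (s * s + q\<^sup>2)) + (2 * M * c - 2 * q * c\<^sup>2) * s"
      by (simp add: power2_eq_square algebra_simps)
    then show "(erw_mart L p (erw_step (eta, X) x))\<^sup>2 = (M\<^sup>2 - 2 * M * q * c + c\<^sup>2 * (1 + q\<^sup>2)) +
       (2 * M * c - 2 * q * c\<^sup>2) * of_real (real_of_int (erw_sign eta x))"
      unfolding s using erw_mart_step[OF assms, of X x] by (simp add: M_def q_def s_def c_def)
  qed
  also have "\<dots> = (M\<^sup>2 - 2 * M * q * c + c\<^sup>2 * (1 + q\<^sup>2)) + (2 * M * c - 2 * q * c\<^sup>2) * q"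
    by (subst expectation_affine_sign[OF assms]) (simp add: q_def)
  \<comment> \<open>The terms linear in M cancel: this is the orthogonality of the
    increments.\<close>
  also have "\<dots> = M\<^sup>2 + c\<^sup>2 * (1 - q\<^sup>2)"
    by (simp add: power2_eq_square algebra_simps)
  \<comment> \<open>A deliberately loose bound: the 4 cancels the 2 in \<open>c\<close> and leaves 1
    / (1 - p)^2.\<close>
  also have "\<dots> \<le> M\<^sup>2 + c\<^sup>2 * 4"
    using zero_le_power2[of q] by (intro add_left_mono mult_left_mono) (linarith, simp)
  also have "c\<^sup>2 * 4 = 1 / (1 - p)\<^sup>2" by (simp only: c_def power_divide power_mult_distrib) simp
  finally show ?thesis by (simp add: M_def)
qed

lemma expectation_erw_mart_sq:
  assumes "fst st \<in> erw_mem L"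
  shows "measure_pmf.expectation (erw_law L p st n) (\<lambda>s. (erw_mart L p s)\<^sup>2) \<le> (erw_mart L p st)\<^sup>2 + real n / (1 - p)\<^sup>2"
proof (induction n)
  case (Suc n)
  note int = integrable_measure_pmf_finite[OF finite_erw_law]
  have "measure_pmf.expectation (erw_law L p st (Suc n)) (\<lambda>s. (erw_mart L p s)\<^sup>2) \<le>
      measure_pmf.expectation (erw_law L p st n) (\<lambda>s. (erw_mart L p s)\<^sup>2 + 1 / (1 - p)\<^sup>2)"
    unfolding expectation_erw_law_Suc
  proof (rule integral_mono_AE[OF int int])
    show "AE s in erw_law L p st n. measure_pmf.expectation (erw_noise L p) (\<lambda>x. (erw_mart L p (erw_step s x))\<^sup>2)
       \<le> (erw_mart L p s)\<^sup>2 + 1 / (1 - p)\<^sup>2"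
    proof (subst AE_measure_pmf_iff, rule ballI)
      fix s assume "s \<in> set_pmf (erw_law L p st n)"
      then have "fst s \<in> erw_mem L" by (rule erw_law_mem[OF assms])
      then show "measure_pmf.expectation (erw_noise L p) (\<lambda>x. (erw_mart L p (erw_step s x))\<^sup>2)
         \<le> (erw_mart L p s)\<^sup>2 + 1 / (1 - p)\<^sup>2"
        using expectation_erw_mart_sq_step[of "fst s" "snd s"] by simp
    qed
  qed
  also have "\<dots> = measure_pmf.expectation (erw_law L p st n) (\<lambda>s. (erw_mart L p s)\<^sup>2) + 1 / (1 - p)\<^sup>2"
    by (subst Bochner_Integration.integral_add[OF int int]) simp
  also have "\<dots> \<le> (erw_mart L p st)\<^sup>2 + real n / (1 - p)\<^sup>2 + 1 / (1 - p)\<^sup>2"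
    using Suc by simp
  finally show ?case by (simp add: add_divide_distrib)
qed simp

section \<open>One step and n steps of the perturbed exponential\<close>

lemma erw_den_ge: "erw_den L p \<ge> 1"
proof -
  have "erw_den L p - 1 = 2 * (1 - p) * (real L - 1)" by (simp add: erw_den_def algebra_simps)
  also have "\<dots> \<ge> 0" using L p1 by simp
  finally show ?thesis by simp
qed

text \<open>Both follow from (2 p - 1)^2 <= 1 <= \<open>erw_den L p\<close>.\<close>

lemma erw_rate_bounds: "0 \<le> erw_rate L p" "erw_rate L p \<le> 1"
proof -
  have "(2 * p - 1)\<^sup>2 \<le> 1" using p0 p1 by (simp add: abs_square_le_1)
  then show "0 \<le> erw_rate L p" "erw_rate L p \<le> 1" using erw_den_ge
    by (auto simp: erw_rate_def field_simps)
qed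

text \<open>The scaled Poisson equation. With q the drift and v the rate, the part outside the
  martingale increment is half the deviation of the conditional variance 1 - q^2 from v.\<close>

lemma kappa_corrector_step:
  assumes eta: "eta \<in> erw_mem L"
  shows "erw_kappa L p * erw_corrector L p (fst (erw_step (eta, X) x)) = erw_kappa L p * erw_corrector L p eta
     + erw_kappa L p * ((real_of_int (erw_sign eta x) - erw_drift L p eta) * pmoment (memr eta) L)
     + ((1 - erw_rate L p) - (erw_drift L p eta)\<^sup>2) / 2"
proof -
  define S a l D where "S = psum (memr eta) L" and "a = 2 * p - 1" and "l = real L" and "D = erw_den L p"
  have D: "D = (1 - a) * l + a" "D > 0" "l > 0"
    using erw_den_ge L by (auto simp: erw_den_def D_def a_def l_def algebra_simps)
  define c where "c = a / l * l * (l - 1) / 2 - (1 - a / l * (l - 1)) * (S\<^sup>2 - l) / 2"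
  have step: "erw_corrector L p (fst (erw_step (eta, X) x)) = erw_corrector L p eta +
      (real_of_int (erw_sign eta x) - erw_drift L p eta) * pmoment (memr eta) L + c"
    using eta L corrector_memr_step[of eta L "a / l" "erw_sign eta x"] memr_sq[OF eta]
    by (simp add: erw_corrector_def erw_step_eq erw_mem_def erw_drift_def S_def a_def l_def c_def)
  have "a\<^sup>2 / (l * D) * c
     = (a\<^sup>2 / D - (a / l * S)\<^sup>2) / 2"
  proof -
    have R: "1 - a / l * (l - 1) = D / l" using D by (simp add: field_simps)
    \<comment> \<open>The constant part is (a (l - 1) + D) / 2 = l / 2. The factor a^2 / (l D) then
      turns the S^2 term into half the squared drift.\<close>
    have Q: "c
       = (l - D / l * S\<^sup>2) / 2"
      unfolding c_def R using D(3) unfolding D(1) by (simp add: field_simps)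
    show ?thesis unfolding Q using D(2,3) by (simp add: field_simps power2_eq_square)
  qed
  moreover have "erw_kappa L p = a\<^sup>2 / (l * D)" "1 - erw_rate L p = a\<^sup>2 / D" "erw_drift L p eta = a / l * S"
    by (simp_all add: erw_kappa_def erw_rate_def erw_drift_def a_def l_def D_def S_def)
  ultimately show ?thesis
    unfolding step distrib_left by simp
qed

text \<open>To second order the exponential contributes the random term -u^2 (1 - q^2) / 2, and the
  corrector adds u^2 ((1 - q^2) - v) / 2. The sum is the constant -u^2 v / 2.\<close>

lemma erw_pert_step:
  assumes eta: "eta \<in> erw_mem L" and u: "\<bar>u\<bar> \<le> 1"
    and B: "\<And>eta. eta \<in> erw_mem L \<Longrightarrow> \<bar>erw_kappa L p * erw_corrector L p eta\<bar> \<le> B"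
  shows "norm (measure_pmf.expectation (erw_noise L p) (\<lambda>x. erw_pert L p u (erw_step (eta, X) x))
     - of_real (1 - u\<^sup>2 * erw_rate L p / 2) * erw_pert L p u (eta, X)) \<le> (2 + 3 * B) * \<bar>u\<bar> ^ 3"
proof -
  define z K T q v where "z = iexp (2 * (1 - p) * u * erw_mart L p (eta, X))" and "K = erw_kappa L p * erw_corrector L p eta"
    and "T = erw_kappa L p * pmoment (memr eta) L" and "q = erw_drift L p eta" and "v = erw_rate L p"
  define s where "s x = real_of_int (erw_sign eta x)" for x
  define K' where "K' x = erw_kappa L p * erw_corrector L p (fst (erw_step (eta, X) x))" for x
  \<comment> \<open>The second order expansion of the next value of \<open>erw_pert\<close>, divided
    by z; the product of the corrector term with the linear term is of order u^3 and left to the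
    error.\<close>
  define h where "h x = 1 + \<i> * of_real (u * (s x - q)) - of_real ((u * (s x - q))\<^sup>2) / 2
      + of_real (u\<^sup>2 * K' x)" for x
  have B0: "0 \<le> B" using B[OF eta] by linarith
  have nz: "norm z = 1" by (simp add: z_def)
  have K': "K' x = K + (s x - q) * T + ((1 - v) - q\<^sup>2) / 2" for x
    using kappa_corrector_step[OF eta, of X x]
    by (simp add: K'_def K_def s_def q_def T_def v_def mult_ac)
  define A0 A1 :: complex where
    "A0 = of_real (1 - u\<^sup>2 * (1 + q\<^sup>2) / 2 + u\<^sup>2 * (K - q * T + ((1 - v) - q\<^sup>2) / 2)) - \<i> * of_real (u * q)"
    and "A1 = \<i> * of_real u + of_real (u\<^sup>2 * q + u\<^sup>2 * T)"
  have "measure_pmf.expectation (erw_noise L p) (\<lambda>x. z * h x) =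
    measure_pmf.expectation (erw_noise L p) (\<lambda>x. z * A0 + z * A1 * of_real (real_of_int (erw_sign eta x)))"
  proof (rule expectation_noise_cong)
    fix x :: "nat \<times> bool" assume x: "fst x < L"
    have ss: "s x * s x = 1" unfolding s_def by (rule erw_sign_sq[OF eta x])
    have "(u * (s x - q))\<^sup>2 = u\<^sup>2 * (s x * s x + q\<^sup>2 - 2 * q * s x)"
      by (simp add: power2_eq_square algebra_simps)
    then have e2: "(u * (s x - q))\<^sup>2 = u\<^sup>2 * (1 + q\<^sup>2 - 2 * q * s x)" unfolding ss .
    have "h x = A0 + A1 * of_real (s x)"
      unfolding h_def e2 K' A0_def A1_def by (simp add: field_simps)
    then show "z * h x = z * A0 + z * A1 * of_real (real_of_int (erw_sign eta x))"
      by (simp add: s_def algebra_simps)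
  qed
  also have "\<dots> = z * (A0 + A1 * of_real q)"
    by (subst expectation_affine_sign[OF eta]) (simp add: q_def algebra_simps)
  \<comment> \<open>The imaginary parts cancel because s - q has mean 0, and so do the terms with T;
    the q^2 terms cancel by the choice of \<open>erw_kappa\<close>.\<close>
  also have "A0 + A1 * of_real q = of_real (1 + u\<^sup>2 * K - u\<^sup>2 * v / 2)"
    unfolding A0_def A1_def by (simp add: field_simps power2_eq_square)
  finally have Eh: "measure_pmf.expectation (erw_noise L p) (\<lambda>x. z * h x) = z * of_real (1 + u\<^sup>2 * K - u\<^sup>2 * v / 2)" .
  have "norm (measure_pmf.expectation (erw_noise L p) (\<lambda>x. erw_pert L p u (erw_step (eta, X) x))
     - measure_pmf.expectation (erw_noise L p) (\<lambda>x. z * h x)) \<le> (2 + 2 * B) * \<bar>u\<bar> ^ 3"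
  proof (rule norm_expectation_diff_le[OF finite_erw_noise])
    fix x assume "x \<in> set_pmf (erw_noise L p)"
    then have x: "fst x < L" using set_erw_noise by auto
    define e where "e = u * (s x - q)"
    have "\<bar>s x - q\<bar> \<le> 2"
      using erw_sign_mem[OF eta x] abs_erw_drift_le[OF eta] by (auto simp: s_def q_def)
    then have e: "\<bar>e\<bar> \<le> 2 * \<bar>u\<bar>" by (simp add: e_def abs_mult mult_left_mono mult.commute[of 2])
    have "fst (erw_step (eta, X) x) \<in> erw_mem L"
      using erw_step_mem[of "(eta, X)" x] eta x by simp
    then have KB: "\<bar>K' x\<bar> \<le> B" unfolding K'_def by (rule B)
    have "2 * (1 - p) * u * erw_mart L p (erw_step (eta, X) x) = 2 * (1 - p) * u * erw_mart L p (eta, X) + e"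
      unfolding erw_mart_step[OF eta] e_def s_def q_def using p1 by (simp add: distrib_left)
    then have "erw_pert L p u (erw_step (eta, X) x) =
        iexp (2 * (1 - p) * u * erw_mart L p (eta, X) + e) * of_real (1 + u\<^sup>2 * K' x)"
      by (simp only: erw_pert_def K'_def mult.assoc)
    also have "iexp (2 * (1 - p) * u * erw_mart L p (eta, X) + e) = z * iexp e"
      by (simp only: z_def of_real_add distrib_left exp_add)
    finally have "erw_pert L p u (erw_step (eta, X) x) = z * iexp e * of_real (1 + u\<^sup>2 * K' x)" .
    then have "erw_pert L p u (erw_step (eta, X) x) - z * h x =
       z * ((iexp e - (1 + \<i> * of_real e - of_real (e\<^sup>2) / 2)) + of_real (u\<^sup>2 * K' x) * (iexp e - 1))"
      unfolding h_def e_def[symmetric] by (simp add: algebra_simps)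
    also have "norm \<dots> \<le> norm (iexp e - (1 + \<i> * of_real e - of_real (e\<^sup>2) / 2)) + norm (of_real (u\<^sup>2 * K' x) * (iexp e - 1))"
      unfolding norm_mult[of z] nz by (simp add: norm_triangle_ineq)
    also have "\<dots> \<le> \<bar>e\<bar> ^ 3 / 6 + (\<bar>u\<bar>\<^sup>2 * B) * \<bar>e\<bar>"
    proof (rule add_mono[OF norm_iexp_taylor2_le])
      have "norm (complex_of_real (u\<^sup>2 * K' x)) \<le> \<bar>u\<bar>\<^sup>2 * B"
        using KB by (simp add: norm_mult norm_power abs_mult mult_left_mono)
      then show "norm (of_real (u\<^sup>2 * K' x) * (iexp e - 1)) \<le> (\<bar>u\<bar>\<^sup>2 * B) * \<bar>e\<bar>"
        unfolding norm_mult using norm_iexp_minus_1_le[of e] B0 by (intro mult_mono) auto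
    qed
    also have "\<dots> \<le> (2 * \<bar>u\<bar>) ^ 3 / 6 + (\<bar>u\<bar>\<^sup>2 * B) * (2 * \<bar>u\<bar>)"
      using e B0 by (intro add_mono divide_right_mono power_mono mult_left_mono) auto
    also have "\<dots> = (4 / 3 + 2 * B) * \<bar>u\<bar> ^ 3"
      by (simp add: power_numeral_reduce distrib_right)
    also have "\<dots> \<le> (2 + 2 * B) * \<bar>u\<bar> ^ 3"
      by (intro mult_right_mono) auto
    finally show "norm (erw_pert L p u (erw_step (eta, X) x) - z * h x) \<le> (2 + 2 * B) * \<bar>u\<bar> ^ 3" .
  qed
  \<comment> \<open>Factoring (1 - u^2 v / 2) (1 + u^2 K) costs only u^4 v K / 2, which is below B
    |u|^3 as |u| and v are at most 1.\<close>
  moreover have "norm (z * of_real (1 + u\<^sup>2 * K - u\<^sup>2 * v / 2)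
      - of_real (1 - u\<^sup>2 * v / 2) * erw_pert L p u (eta, X)) \<le> B * \<bar>u\<bar> ^ 3"
  proof -
    have pe: "erw_pert L p u (eta, X) = z * of_real (1 + u\<^sup>2 * K)"
      by (simp only: erw_pert_def z_def K_def fst_conv mult.assoc)
    have "z * of_real (1 + u\<^sup>2 * K - u\<^sup>2 * v / 2) - of_real (1 - u\<^sup>2 * v / 2) * erw_pert L p u (eta, X)
        = z * of_real (u\<^sup>2 * u\<^sup>2 * v / 2 * K)"
      unfolding pe by (simp add: algebra_simps)
    also have "norm \<dots> = \<bar>u\<bar> ^ 3 * (\<bar>u\<bar> * (v / 2) * \<bar>K\<bar>)"
      using erw_rate_bounds
      by (simp only: norm_mult nz norm_of_real) (simp add: abs_mult power2_eq_square power3_eq_cube v_def)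
    also have "\<dots> \<le> \<bar>u\<bar> ^ 3 * (1 * 1 * B)"
      using erw_rate_bounds u B[OF eta]
      by (intro mult_left_mono mult_mono) (auto simp: v_def K_def)
    finally show ?thesis by (simp add: mult.commute)
  qed
  ultimately have "norm ((measure_pmf.expectation (erw_noise L p) (\<lambda>x. erw_pert L p u (erw_step (eta, X) x))
     - measure_pmf.expectation (erw_noise L p) (\<lambda>x. z * h x)) +
     (z * of_real (1 + u\<^sup>2 * K - u\<^sup>2 * v / 2) - of_real (1 - u\<^sup>2 * v / 2) * erw_pert L p u (eta, X)))
     \<le> (2 + 2 * B) * \<bar>u\<bar> ^ 3 + B * \<bar>u\<bar> ^ 3"
    by (intro norm_triangle_le add_mono)
  then show ?thesis unfolding Eh by (simp add: v_def algebra_simps)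
qed

text \<open>The factor has modulus at most 1 because |u| <= 1 and the rate lies in [0, 1], so
  earlier errors are not amplified and n one-step errors simply add up.\<close>

lemma expectation_erw_pert:
  assumes st: "fst st \<in> erw_mem L" and u: "\<bar>u\<bar> \<le> 1"
    and B: "\<And>eta. eta \<in> erw_mem L \<Longrightarrow> \<bar>erw_kappa L p * erw_corrector L p eta\<bar> \<le> B"
  shows "norm (measure_pmf.expectation (erw_law L p st n) (erw_pert L p u)
     - of_real (1 - u\<^sup>2 * erw_rate L p / 2) ^ n * erw_pert L p u st) \<le> real n * ((2 + 3 * B) * \<bar>u\<bar> ^ 3)"
proof (induction n)
  case (Suc n)
  define \<rho> E where "\<rho> = 1 - u\<^sup>2 * erw_rate L p / 2" and "E = (\<lambda>n. measure_pmf.expectation (erw_law L p st n) (erw_pert L p u))"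
  have "0 \<le> u\<^sup>2 * erw_rate L p" "u\<^sup>2 * erw_rate L p \<le> 1"
    using erw_rate_bounds u by (auto intro!: mult_le_one simp: abs_square_le_1)
  then have \<rho>: "\<bar>\<rho>\<bar> \<le> 1" by (simp add: \<rho>_def)
  have "norm (E (Suc n) - measure_pmf.expectation (erw_law L p st n) (\<lambda>s. of_real \<rho> * erw_pert L p u s))
      \<le> (2 + 3 * B) * \<bar>u\<bar> ^ 3"
    unfolding E_def expectation_erw_law_Suc
  proof (rule norm_expectation_diff_le[OF finite_erw_law])
    fix s assume "s \<in> set_pmf (erw_law L p st n)"
    then have "fst s \<in> erw_mem L" by (rule erw_law_mem[OF st])
    then show "norm (measure_pmf.expectation (erw_noise L p) (\<lambda>x. erw_pert L p u (erw_step s x)) -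
           of_real \<rho> * erw_pert L p u s) \<le> (2 + 3 * B) * \<bar>u\<bar> ^ 3"
      using erw_pert_step[OF _ u B, of "fst s" "snd s"] by (simp add: \<rho>_def)
  qed
  then have 1: "norm (E (Suc n) - of_real \<rho> * E n) \<le> (2 + 3 * B) * \<bar>u\<bar> ^ 3"
    by (simp add: E_def)
  have "norm (of_real \<rho> * (E n - of_real \<rho> ^ n * erw_pert L p u st)) \<le> 1 * (real n * ((2 + 3 * B) * \<bar>u\<bar> ^ 3))"
    unfolding norm_mult
  proof (rule mult_mono)
    show "norm (complex_of_real \<rho>) \<le> 1" using \<rho> by (simp only: norm_of_real)
    show "norm (E n - of_real \<rho> ^ n * erw_pert L p u st) \<le> real n * ((2 + 3 * B) * \<bar>u\<bar> ^ 3)"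
      using Suc unfolding \<rho>_def E_def .
  qed simp_all
  then have "norm ((E (Suc n) - of_real \<rho> * E n) + of_real \<rho> * (E n - of_real \<rho> ^ n * erw_pert L p u st))
     \<le> (2 + 3 * B) * \<bar>u\<bar> ^ 3 + 1 * (real n * ((2 + 3 * B) * \<bar>u\<bar> ^ 3))"
    using 1 by (intro norm_triangle_le add_mono)
  then show ?case
    by (simp add: E_def \<rho>_def algebra_simps)
qed simp

text \<open>Passes from the perturbed exponential of the martingale to that of the walk. The memory
  term costs order u and the corrector u^2 <= |u|, both being bounded on the memories. The constant
  C depends on neither u nor n, so u may later vary with n.\<close>

lemma expectation_iexp:
  assumes st: "fst st \<in> erw_mem L"
  obtains C where "\<And>u n. \<bar>u\<bar> \<le> 1 \<Longrightarrow>
    norm (measure_pmf.expectation (erw_law L p st n) (\<lambda>s. iexp (2 * (1 - p) * u * real_of_int (snd s)))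
     - of_real (1 - u\<^sup>2 * erw_rate L p / 2) ^ n * erw_pert L p u st) \<le> C * (\<bar>u\<bar> + real n * \<bar>u\<bar> ^ 3)"
proof -
  define W where "W eta = (2 * p - 1) / real L * (pmoment (memr eta) L + psum (memr eta) L)" for eta
  \<comment> \<open>A sum over the finite set of memories serves as a common bound for both
    terms.\<close>
  define B where "B = (\<Sum>eta\<in>erw_mem L. \<bar>erw_kappa L p * erw_corrector L p eta\<bar> + \<bar>W eta\<bar>)"
  have BW: "\<bar>erw_kappa L p * erw_corrector L p eta\<bar> + \<bar>W eta\<bar> \<le> B" if "eta \<in> erw_mem L" for eta
    unfolding B_def by (rule member_le_sum[OF that _ finite_erw_mem]) simp
  have B: "\<bar>erw_kappa L p * erw_corrector L p eta\<bar> \<le> B" and W: "\<bar>W eta\<bar> \<le> B" if "eta \<in> erw_mem L" for eta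
    using BW[OF that] by linarith+
  have B0: "B \<ge> 0" unfolding B_def by (intro sum_nonneg) simp
  have "norm (measure_pmf.expectation (erw_law L p st n) (\<lambda>s. iexp (2 * (1 - p) * u * real_of_int (snd s)))
     - of_real (1 - u\<^sup>2 * erw_rate L p / 2) ^ n * erw_pert L p u st) \<le> (2 + 3 * B) * (\<bar>u\<bar> + real n * \<bar>u\<bar> ^ 3)"
    if u: "\<bar>u\<bar> \<le> 1" for u n
  proof -
    have "norm (measure_pmf.expectation (erw_law L p st n) (\<lambda>s. iexp (2 * (1 - p) * u * real_of_int (snd s)))
        - measure_pmf.expectation (erw_law L p st n) (erw_pert L p u)) \<le> 2 * B * \<bar>u\<bar>"
    proof (rule norm_expectation_diff_le[OF finite_erw_law])
      fix s assume "s \<in> set_pmf (erw_law L p st n)"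
      then have s: "fst s \<in> erw_mem L" by (rule erw_law_mem[OF st])
      define x y where "x = 2 * (1 - p) * u * real_of_int (snd s)" and "y = 2 * (1 - p) * u * erw_mart L p s"
      have "y - x = u * W (fst s)"
        using L p1 by (simp add: x_def y_def erw_mart_def W_def distrib_left)
      then have "\<bar>x - y\<bar> \<le> \<bar>u\<bar> * B"
        using W[OF s] by (simp add: abs_minus_commute[of x y] abs_mult mult_left_mono)
      then have 1: "norm (iexp x - iexp y) \<le> \<bar>u\<bar> * B" using norm_iexp_diff_le[of x y] by linarith
      have "u\<^sup>2 \<le> \<bar>u\<bar>" using u mult_left_mono[of "\<bar>u\<bar>" 1 "\<bar>u\<bar>"] by (simp add: power2_eq_square)
      then have 2: "norm (iexp y * of_real (u\<^sup>2 * (erw_kappa L p * erw_corrector L p (fst s)))) \<le> \<bar>u\<bar> * B"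
        unfolding norm_mult norm_of_real using B[OF s] by (simp add: abs_mult mult_mono)
      have "norm ((iexp x - iexp y) - iexp y * of_real (u\<^sup>2 * (erw_kappa L p * erw_corrector L p (fst s)))) \<le> \<bar>u\<bar> * B + \<bar>u\<bar> * B"
        by (rule order.trans[OF norm_triangle_ineq4 add_mono[OF 1 2]])
      moreover have "erw_pert L p u s = iexp y * of_real (1 + u\<^sup>2 * (erw_kappa L p * erw_corrector L p (fst s)))"
        by (simp only: erw_pert_def y_def mult.assoc)
      ultimately show "norm (iexp (2 * (1 - p) * u * real_of_int (snd s)) - erw_pert L p u s) \<le> 2 * B * \<bar>u\<bar>"
        unfolding x_def[symmetric] by (simp add: algebra_simps)
    qed
    from norm_triangle_mono[OF this expectation_erw_pert[OF st u B, of n]]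
    have "norm (measure_pmf.expectation (erw_law L p st n) (\<lambda>s. iexp (2 * (1 - p) * u * real_of_int (snd s)))
     - of_real (1 - u\<^sup>2 * erw_rate L p / 2) ^ n * erw_pert L p u st) \<le> 2 * B * \<bar>u\<bar> + real n * ((2 + 3 * B) * \<bar>u\<bar> ^ 3)"
      by simp
    also have "\<dots> \<le> (2 + 3 * B) * \<bar>u\<bar> + real n * ((2 + 3 * B) * \<bar>u\<bar> ^ 3)"
      using B0 by (intro add_right_mono mult_right_mono) auto
    finally show ?thesis by (simp add: algebra_simps)
  qed
  then show ?thesis by (rule that)
qed

section \<open>Strong law of large numbers\<close>

lemma integral_erw_state:
  fixes f :: "int list \<times> int \<Rightarrow> 'b::{banach, second_countable_topology}"
  shows "(\<integral>\<omega>. f (erw_state eta X \<omega> n) \<partial>erw_space L p) = measure_pmf.expectation (erw_law L p (eta, X) n) f"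
  unfolding distr_erw_state[symmetric] by (subst integral_distr) auto

text \<open>The stream space also contains streams with positions beyond the list; these have
  probability 0.\<close>

lemma AE_erw_state:
  assumes "eta \<in> erw_mem L"
  shows "AE \<omega> in erw_space L p. \<forall>n. fst (erw_state eta X \<omega> n) \<in> erw_mem L"
proof (subst AE_all_countable, rule allI)
  fix n
  have "AE s in erw_law L p (eta, X) n. fst s \<in> erw_mem L"
    using erw_law_mem[of "(eta, X)"] assms by (simp add: AE_measure_pmf_iff)
  then show "AE \<omega> in erw_space L p. fst (erw_state eta X \<omega> n) \<in> erw_mem L"
    unfolding distr_erw_state[symmetric] by (subst (asm) AE_distr_iff) auto
qed

text \<open>The increment is the last entry of the memory after the step, hence the condition at
  \<open>Suc n\<close>.\<close>

lemma erw_pos_step: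
  assumes "fst (erw_state eta X \<omega> (Suc n)) \<in> erw_mem L"
  shows "\<bar>erw_pos eta X \<omega> (Suc n) - erw_pos eta X \<omega> n\<bar> \<le> 1"
proof -
  obtain eta' X' where s: "erw_state eta X \<omega> n = (eta', X')" by fastforce
  have "erw_sign eta' (\<omega> !! n) \<in> {-1, 1}"
    using assms by (auto simp: s erw_step_eq erw_mem_def)
  then show ?thesis by (auto simp: erw_pos_def s erw_step_eq)
qed

text \<open>The squared quotient has expectation at most C / k^2. These bounds are summable, so the
  squares have an almost surely finite sum and tend to 0.\<close>

lemma AE_erw_mart_squares:
  assumes "eta \<in> erw_mem L"
  shows "AE \<omega> in erw_space L p. (\<lambda>k. erw_mart L p (erw_state eta X \<omega> (k\<^sup>2)) / (real k)\<^sup>2) \<longlonglongrightarrow> 0"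
proof -
  define C where "C = (erw_mart L p (eta, X))\<^sup>2 + 1 / (1 - p)\<^sup>2"
  \<comment> \<open>Indexing by \<open>Suc k\<close> avoids the division by zero at k = 0; the shift
    is undone in the last step.\<close>
  define f where "f k \<omega> = (erw_mart L p (erw_state eta X \<omega> ((Suc k)\<^sup>2)) / (real (Suc k))\<^sup>2)\<^sup>2" for k \<omega>
  have meas [measurable]: "f k \<in> borel_measurable (erw_space L p)" for k
    unfolding f_def by (rule borel_measurable_erw_state)
  have C0: "C \<ge> 0" by (simp add: C_def)
  have bound: "(\<integral>\<^sup>+\<omega>. ennreal (f k \<omega>) \<partial>erw_space L p) \<le> ennreal (C * (1 / (real (Suc k))\<^sup>2))" for k
  proof -
    define P where "P = erw_law L p (eta, X) ((Suc k)\<^sup>2)"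
    define m where "m = (real (Suc k))\<^sup>2"
    have m: "m \<ge> 1" by (simp add: m_def)
    note int = integrable_measure_pmf_finite[OF finite_erw_law]
    have "(\<integral>\<^sup>+\<omega>. ennreal (f k \<omega>) \<partial>erw_space L p) = (\<integral>\<^sup>+s. ennreal ((erw_mart L p s / m)\<^sup>2) \<partial>P)"
      unfolding P_def distr_erw_state[symmetric] f_def m_def by (subst nn_integral_distr) auto
    also have "\<dots> = ennreal (measure_pmf.expectation P (\<lambda>s. (erw_mart L p s / m)\<^sup>2))"
      by (rule nn_integral_eq_integral) (auto simp: P_def int)
    also have "measure_pmf.expectation P (\<lambda>s. (erw_mart L p s / m)\<^sup>2) = measure_pmf.expectation P (\<lambda>s. (erw_mart L p s)\<^sup>2) / m\<^sup>2"
      by (simp add: power_divide)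
    also have "\<dots> \<le> ((erw_mart L p (eta, X))\<^sup>2 + m / (1 - p)\<^sup>2) / m\<^sup>2"
      using expectation_erw_mart_sq[of "(eta, X)" "(Suc k)\<^sup>2"] assms
      by (intro divide_right_mono) (simp_all add: P_def m_def)
    \<comment> \<open>Since m >= 1, the initial value can be absorbed into the term linear in m,
      which makes C independent of k.\<close>
    also have "\<dots> \<le> (m * (erw_mart L p (eta, X))\<^sup>2 + m / (1 - p)\<^sup>2) / m\<^sup>2"
      using m mult_right_mono[OF m, of "(erw_mart L p (eta, X))\<^sup>2"] by (intro divide_right_mono add_right_mono) auto
    also have "\<dots> = C * (1 / m)" using m by (simp add: C_def power2_eq_square divide_simps) (simp add: algebra_simps)
    finally show ?thesis unfolding m_def by (simp add: ennreal_leI)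
  qed
  have "summable (\<lambda>k. C * (1 / (real (Suc k))\<^sup>2))"
    using inverse_power_summable[of 2, where 'a = real]
    by (intro summable_mult)
      (simp add: summable_Suc_iff[where f = "\<lambda>k. 1 / (real k)\<^sup>2"] inverse_eq_divide del: of_nat_Suc)
  then have "(\<Sum>k. ennreal (C * (1 / (real (Suc k))\<^sup>2))) < \<infinity>"
    using C0 by (subst suminf_ennreal2) auto
  moreover have "(\<integral>\<^sup>+\<omega>. (\<Sum>k. ennreal (f k \<omega>)) \<partial>erw_space L p) \<le> (\<Sum>k. ennreal (C * (1 / (real (Suc k))\<^sup>2)))"
    using bound by (subst nn_integral_suminf) (auto intro!: suminf_le simp del: of_nat_Suc)
  ultimately have "(\<integral>\<^sup>+\<omega>. (\<Sum>k. ennreal (f k \<omega>)) \<partial>erw_space L p) \<noteq> \<infinity>" by auto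
  then have "AE \<omega> in erw_space L p. (\<Sum>k. ennreal (f k \<omega>)) \<noteq> \<infinity>"
    by (intro nn_integral_PInf_AE) auto
  then show ?thesis
  proof eventually_elim
    case (elim \<omega>)
    have "summable (\<lambda>k. f k \<omega>)"
      using elim by (intro summable_suminf_not_top) (auto simp: f_def)
    then have "(\<lambda>k. f k \<omega>) \<longlonglongrightarrow> 0" by (rule summable_LIMSEQ_zero)
    from tendsto_real_sqrt[OF this]
    have "(\<lambda>k. \<bar>erw_mart L p (erw_state eta X \<omega> ((Suc k)\<^sup>2)) / (real (Suc k))\<^sup>2\<bar>) \<longlonglongrightarrow> 0"
      by (simp only: f_def real_sqrt_abs real_sqrt_zero)
    then have "(\<lambda>k. erw_mart L p (erw_state eta X \<omega> ((Suc k)\<^sup>2)) / (real (Suc k))\<^sup>2) \<longlonglongrightarrow> 0"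
      by (rule tendsto_rabs_zero_cancel)
    then show ?case by (subst (asm) filterlim_sequentially_Suc)
  qed
qed

text \<open>The difference does not involve X, so position 0 represents every position, and only
  finitely many memories remain.\<close>

lemma memory_term_bounded:
  obtains B where "\<And>eta X. eta \<in> erw_mem L \<Longrightarrow> \<bar>erw_mart L p (eta, X) - real_of_int X\<bar> \<le> B"
proof -
  define B where "B = (\<Sum>eta\<in>erw_mem L. \<bar>erw_mart L p (eta, 0)\<bar>)"
  have "\<bar>erw_mart L p (eta, X) - real_of_int X\<bar> \<le> B" if "eta \<in> erw_mem L" for eta X
    using member_le_sum[OF that _ finite_erw_mem, of "\<lambda>eta. \<bar>erw_mart L p (eta, 0)\<bar>"]
    by (simp add: B_def erw_mart_def)
  then show ?thesis by (rule that)
qed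

lemma strong_law:
  assumes "eta \<in> erw_mem L"
  shows "AE \<omega> in erw_space L p. (\<lambda>t. real_of_int (erw_pos eta X \<omega> t) / real t) \<longlonglongrightarrow> 0"
proof -
  obtain B where B: "\<And>eta X. eta \<in> erw_mem L \<Longrightarrow> \<bar>erw_mart L p (eta, X) - real_of_int X\<bar> \<le> B"
    using memory_term_bounded by blast
  show ?thesis using AE_erw_state[OF assms, of X] AE_erw_mart_squares[OF assms, of X]
  proof eventually_elim
    case (elim \<omega>)
    show ?case
    proof (rule LIMSEQ_of_bounded_steps)
      show "\<bar>real_of_int (erw_pos eta X \<omega> (Suc n)) - real_of_int (erw_pos eta X \<omega> n)\<bar> \<le> 1" for n
      proof -
        have "real_of_int \<bar>erw_pos eta X \<omega> (Suc n) - erw_pos eta X \<omega> n\<bar> \<le> real_of_int 1"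
          unfolding of_int_le_iff using elim(1) by (intro erw_pos_step) blast
        then show ?thesis by (simp only: of_int_abs of_int_diff of_int_1)
      qed
      define D where "D k = erw_mart L p (erw_state eta X \<omega> (k\<^sup>2)) - real_of_int (erw_pos eta X \<omega> (k\<^sup>2))" for k
      have "\<bar>D k\<bar> \<le> B" for k
        using B[of "fst (erw_state eta X \<omega> (k\<^sup>2))" "snd (erw_state eta X \<omega> (k\<^sup>2))"] elim(1)
        by (simp add: D_def erw_pos_def)
      then have "norm (D k / (real k)\<^sup>2) \<le> B / (real k)\<^sup>2" for k
        by (simp add: divide_right_mono)
      then have "(\<lambda>k. D k / (real k)\<^sup>2) \<longlonglongrightarrow> 0"
      proof (rule Lim_null_comparison[OF always_eventually, OF allI])
        show "(\<lambda>k. B / (real k)\<^sup>2) \<longlonglongrightarrow> 0"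
          by (intro tendsto_divide_0[OF tendsto_const] filterlim_at_top_imp_at_infinity
              filterlim_pow_at_top filterlim_real_sequentially) simp
      qed
      from tendsto_diff[OF elim(2) this]
      show "(\<lambda>k. real_of_int (erw_pos eta X \<omega> (k\<^sup>2)) / (real k)\<^sup>2) \<longlonglongrightarrow> 0"
        by (simp add: D_def diff_divide_distrib)
    qed
  qed
qed

section \<open>Limit of the characteristic functions\<close>

lemma char_limit:
  assumes eta: "eta \<in> erw_mem L"
  shows "(\<lambda>t. char (distr (erw_space L p) borel
      (\<lambda>\<omega>. real_of_int (erw_pos eta X \<omega> t) / sqrt (real t))) \<theta>)
    \<longlonglongrightarrow> of_real (exp (- (erw_rate L p / (2 * (1 - p))\<^sup>2 * \<theta>\<^sup>2 / 2)))"
proof -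
  \<comment> \<open>Chosen so that 2 (1 - p) u equals the argument of the characteristic function
    divided by sqrt t, matching the exponent in \<open>erw_pert\<close>.\<close>
  define c where "c = \<theta> / (2 * (1 - p))"
  define u where "u t = c / sqrt (real t)" for t
  obtain C where C: "\<And>u n. \<bar>u\<bar> \<le> 1 \<Longrightarrow>
    norm (measure_pmf.expectation (erw_law L p (eta, X) n) (\<lambda>s. iexp (2 * (1 - p) * u * real_of_int (snd s)))
     - of_real (1 - u\<^sup>2 * erw_rate L p / 2) ^ n * erw_pert L p u (eta, X)) \<le> C * (\<bar>u\<bar> + real n * \<bar>u\<bar> ^ 3)"
    using expectation_iexp[of "(eta, X)"] eta by auto
  define \<phi> where "\<phi> t = char (distr (erw_space L p) borel
      (\<lambda>\<omega>. real_of_int (erw_pos eta X \<omega> t) / sqrt (real t))) \<theta>" for t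
  define \<psi> where "\<psi> t = of_real ((1 - (u t)\<^sup>2 * erw_rate L p / 2) ^ t) * erw_pert L p (u t) (eta, X)" for t
  have \<phi>: "\<phi> t = measure_pmf.expectation (erw_law L p (eta, X) t)
      (\<lambda>s. iexp (2 * (1 - p) * u t * real_of_int (snd s)))" for t
  proof -
    have [measurable]: "(\<lambda>\<omega>. real_of_int (erw_pos eta X \<omega> t) / sqrt (real t)) \<in> borel_measurable (erw_space L p)"
      unfolding erw_pos_def by (rule borel_measurable_erw_state)
    have "\<phi> t = (\<integral>\<omega>. iexp (\<theta> * (real_of_int (snd (erw_state eta X \<omega> t)) / sqrt (real t))) \<partial>erw_space L p)"
      unfolding \<phi>_def char_def by (subst integral_distr) (auto simp: erw_pos_def)
    also have "\<dots> = measure_pmf.expectation (erw_law L p (eta, X) t) (\<lambda>s. iexp (\<theta> * (real_of_int (snd s) / sqrt (real t))))"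
      by (rule integral_erw_state)
    also have "(\<lambda>s :: int list \<times> int. iexp (\<theta> * (real_of_int (snd s) / sqrt (real t)))) =
        (\<lambda>s. iexp (2 * (1 - p) * u t * real_of_int (snd s)))"
      using p1 by (simp add: u_def c_def)
    finally show ?thesis .
  qed
  have u0: "u \<longlonglongrightarrow> 0" unfolding u_def
    by (intro tendsto_divide_0[OF tendsto_const] filterlim_at_top_imp_at_infinity
        filterlim_compose[OF sqrt_at_top filterlim_real_sequentially])
  then have "\<forall>\<^sub>F t in sequentially. \<bar>u t\<bar> < 1"
    using order_tendstoD(2)[OF tendsto_rabs_zero[OF u0], of 1] by simp
  then have "\<forall>\<^sub>F t in sequentially. norm (\<phi> t - \<psi> t) \<le> C * (\<bar>u t\<bar> + real t * \<bar>u t\<bar> ^ 3)"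
    by eventually_elim (use C in \<open>simp add: \<phi> \<psi>_def\<close>)
  moreover have "(\<lambda>t. C * (\<bar>u t\<bar> + real t * \<bar>u t\<bar> ^ 3)) \<longlonglongrightarrow> 0"
  proof -
    \<comment> \<open>Two of the three powers of u absorb t; at t = 0 both sides are 0, as
      \<open>u 0 = 0\<close> by division by zero.\<close>
    have "real t * \<bar>u t\<bar> ^ 3 = c\<^sup>2 * \<bar>u t\<bar>" for t
    proof -
      have "real t * \<bar>u t\<bar> ^ 3 = (real t * (u t)\<^sup>2) * \<bar>u t\<bar>"
        by (simp add: power3_eq_cube power2_eq_square)
      then show ?thesis by (cases "t = 0") (simp_all add: u_def power_divide)
    qed
    then show ?thesis
      using tendsto_mult_right_zero[OF tendsto_rabs_zero[OF u0], of "C * (1 + c\<^sup>2)"]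
      by (simp add: algebra_simps)
  qed
  ultimately have "(\<lambda>t. \<phi> t - \<psi> t) \<longlonglongrightarrow> 0" by (rule Lim_null_comparison)
  moreover have "\<psi> \<longlonglongrightarrow> of_real (exp (- (erw_rate L p * c\<^sup>2 / 2))) * of_real 1"
  proof -
    \<comment> \<open>The start state is fixed while u tends to 0, so the initial memory and
      position leave no trace in the limit.\<close>
    have "(\<lambda>t. erw_pert L p (u t) (eta, X)) \<longlonglongrightarrow> iexp (2 * (1 - p) * 0 * erw_mart L p (eta, X)) * of_real (1 + 0\<^sup>2 * erw_kappa L p * erw_corrector L p (fst (eta, X)))"
      unfolding erw_pert_def by (intro tendsto_intros u0)
    then have "(\<lambda>t. erw_pert L p (u t) (eta, X)) \<longlonglongrightarrow> of_real 1" by simp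
    then show ?thesis unfolding \<psi>_def u_def
      by (intro tendsto_mult tendsto_of_real LIMSEQ_power_scaled)
  qed
  ultimately have "(\<lambda>t. (\<phi> t - \<psi> t) + \<psi> t) \<longlonglongrightarrow> 0 + of_real (exp (- (erw_rate L p * c\<^sup>2 / 2))) * of_real 1"
    by (rule tendsto_add)
  moreover have "erw_rate L p * c\<^sup>2 = erw_rate L p / (2 * (1 - p))\<^sup>2 * \<theta>\<^sup>2"
    unfolding c_def power_divide by simp
  ultimately show ?thesis by (simp only: \<phi>_def diff_add_cancel add_0_left of_real_1 mult_1_right)
qed

text \<open>With q = 2 (1 - p), the numerator D - (1 - q)^2 of the rate factors as q (L + 1 - q),
  which cancels one of the two factors q.\<close>

lemma erw_rate_eq:
  "erw_rate L p / (2 * (1 - p))\<^sup>2 =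
     (real L - 1 + 2 * p) / (2 * (1 - p) * (2 * (1 - p) * real L + 2 * p - 1))"
proof -
  define q where "q = 2 * (1 - p)"
  have q: "q > 0" "2 * p - 1 = 1 - q" using p1 by (auto simp: q_def)
  have D: "erw_den L p = q * real L + (1 - q)" by (simp add: erw_den_def q_def)
  have D0: "erw_den L p > 0" using erw_den_ge by linarith
  have "erw_rate L p = (erw_den L p - (1 - q)\<^sup>2) / erw_den L p"
    using D0 by (simp add: erw_rate_def q(2) diff_divide_distrib)
  also have "erw_den L p - (1 - q)\<^sup>2 = q * (real L + (1 - q))"
    unfolding D by (simp add: power2_eq_square algebra_simps)
  finally have "erw_rate L p / q\<^sup>2 = (real L + (1 - q)) / (q * erw_den L p)"
    using q(1) by (simp add: power2_eq_square)
  then show ?thesis by (simp add: erw_den_def q_def)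
qed

end

theorem mainTheorem17:
  fixes L :: nat and p :: real and eta0 :: "int list" and X0 :: int
  assumes "L \<ge> 1"
    and "0 \<le> p" and "p < 1"
    and "length eta0 = L" and "set eta0 \<subseteq> {-1, 1}"
  shows "(AE \<omega> in erw_space L p.
            (\<lambda>t. real_of_int (erw_pos eta0 X0 \<omega> t) / real t) \<longlonglongrightarrow> 0)
       \<and> weak_conv_m
           (\<lambda>t. distr (erw_space L p) borel
                   (\<lambda>\<omega>. real_of_int (erw_pos eta0 X0 \<omega> t) / sqrt (real t)))
           (centered_normal
              ((real L - 1 + 2 * p) / (2 * (1 - p) * (2 * (1 - p) * real L + 2 * p - 1))))"
proof
  interpret elephant L p using assms by unfold_locales
  have eta: "eta0 \<in> erw_mem L" using assms by (simp add: erw_mem_def)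
  show "AE \<omega> in erw_space L p. (\<lambda>t. real_of_int (erw_pos eta0 X0 \<omega> t) / real t) \<longlonglongrightarrow> 0"
    using eta by (rule strong_law)
  \<comment> \<open>Nonnegativity of the variance is evident in this form, so the stated fraction is
    folded back into it.\<close>
  have v: "0 \<le> erw_rate L p / (2 * (1 - p))\<^sup>2" using erw_rate_bounds by simp
  show "weak_conv_m
           (\<lambda>t. distr (erw_space L p) borel
                   (\<lambda>\<omega>. real_of_int (erw_pos eta0 X0 \<omega> t) / sqrt (real t)))
           (centered_normal
              ((real L - 1 + 2 * p) / (2 * (1 - p) * (2 * (1 - p) * real L + 2 * p - 1))))"
    unfolding erw_rate_eq[symmetric]
  proof (rule levy_continuity)
    show "real_distribution (distr (erw_space L p) borel
        (\<lambda>\<omega>. real_of_int (erw_pos eta0 X0 \<omega> t) / sqrt (real t)))" for t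
    proof -
      interpret prob_space "erw_space L p" by (rule prob_space_erw_space)
      show ?thesis unfolding erw_pos_def
        by (rule real_distribution_distr[OF borel_measurable_erw_state])
    qed
    show "real_distribution (centered_normal (erw_rate L p / (2 * (1 - p))\<^sup>2))"
      using v by (rule real_distribution_centered_normal)
    show "(\<lambda>t. char (distr (erw_space L p) borel
        (\<lambda>\<omega>. real_of_int (erw_pos eta0 X0 \<omega> t) / sqrt (real t))) \<theta>)
      \<longlonglongrightarrow> char (centered_normal (erw_rate L p / (2 * (1 - p))\<^sup>2)) \<theta>" for \<theta>
      unfolding char_centered_normal[OF v] using eta by (rule char_limit)
  qed
qed

end
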